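(* Let $\{X_n\}_{n=1}^{\infty}$ be a sequence of random variables with common marginal distribution function $F$, and let $\{x_n\}_{n=1}^\infty$ be a sequence of real numbers such that $n\bar F(x_n)\to\tau$ for some $\tau>0$. Suppose $\{X_n\}$ satisfies AIM$(x_n)$, with associated sequences $q_n$ and $\alpha_n$, and let $p_n$ be a sequence of positive integers such that $p_n=o(n)$, $n\alpha_n=o(p_n)$ and $q_n=o(p_n)$. Let $$\gamma_n=\frac1n\sum_{j=1}^{n}\mathbb{P}(M_{j,j+p_n}\le x_n\mid X_j>x_n).$$ Then $\mathbb{P}(M_n\le x_n)$ converges as $n\to\infty$ if and only if $\lim_{n\to\infty}\gamma_n$ exists, in which case $\mathbb{P}(M_n\le x_n)\to e^{-\tau\gamma}$ with $\gamma=\lim_{n\to\infty}\gamma_n\in[0,1]$.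
   Context: Notation: $\bar F=1-F$; $M_n=\max\{X_1,\dots,X_n\}$; $M_{j,k}=\max\{X_i: j+1\le i\le k\}$; for a set $A$ of positive integers, $M(A)=\max\{X_i:i\in A\}$ and $|A|$ is its number of elements. An interval is a set of consecutive integers. No stationarity of $\{X_n\}$ is assumed. Limits and $o(\cdot)$ are as $n\to\infty$. AIM$(x_n)$ (asymptotic independence of maxima relative to $x_n$): there is a sequence $q_n$ of positive integers with $q_n=o(n)$ such that $$\alpha_n=\max\big|\mathbb{P}(M(I_1\cup I_2)\le x_n)-\mathbb{P}(M(I_1)\le x_n)\,\mathbb{P}(M(I_2)\le x_n)\big|\to 0,$$ where the maximum is over all pairs of intervals of positive integers $I_1=\{i_1,\dots,i_j\}$ and $I_2=\{i_j+q_n+1,\dots,i_j+q_n+k\}$ (so separated by $q_n$ intermediate integers) with $|I_1|\ge q_n$, $|I_2|\ge q_n$ and $i_j+q_n+k\le n$. *)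

theory Defs
  imports "HOL-Probability.Probability" "HOL-Library.Landau_Symbols"
begin

text \<open>
  Sequences are indexed by the positive integers; the value at index 0 of a function on
  \<^typ>\<open>nat\<close> is never constrained and never matters.
\<close>

definition maxon :: "(nat \<Rightarrow> 'a \<Rightarrow> real) \<Rightarrow> nat set \<Rightarrow> 'a \<Rightarrow> real" where
  "maxon X A \<omega> = Max ((\<lambda>i. X i \<omega>) ` A)"

abbreviation maxbetween :: "(nat \<Rightarrow> 'a \<Rightarrow> real) \<Rightarrow> nat \<Rightarrow> nat \<Rightarrow> 'a \<Rightarrow> real" where
  "maxbetween X j k \<equiv> maxon X {j+1..k}"

abbreviation maxupto :: "(nat \<Rightarrow> 'a \<Rightarrow> real) \<Rightarrow> nat \<Rightarrow> 'a \<Rightarrow> real" where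
  "maxupto X n \<equiv> maxon X {1..n}"

definition separated_pairs :: "nat \<Rightarrow> nat \<Rightarrow> (nat set \<times> nat set) set" where
  "separated_pairs q n =
     {(I1, I2). \<exists>a b k. 1 \<le> a \<and> a \<le> b \<and> 1 \<le> k \<and> b + q + k \<le> n \<and>
        I1 = {a..b} \<and> I2 = {b+q+1..b+q+k} \<and> q \<le> card I1 \<and> q \<le> card I2}"

text \<open>
  The maximum below is over a finite set, which is empty only if \<open>n < 3 * q n\<close> (for
  \<open>q n \<ge> 1\<close>); as \<open>q n = o(n)\<close> this happens for finitely many \<open>n\<close> only, so the
  unspecified value of the maximum there is irrelevant.
\<close>

definition aim_alpha ::
    "'a measure \<Rightarrow> (nat \<Rightarrow> 'a \<Rightarrow> real) \<Rightarrow> (nat \<Rightarrow> real) \<Rightarrow> (nat \<Rightarrow> nat) \<Rightarrow> nat \<Rightarrow> real" where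
  "aim_alpha M X x q n =
     Max ((\<lambda>(I1, I2).
            \<bar>\<P>(\<omega> in M. maxon X (I1 \<union> I2) \<omega> \<le> x n)
             - \<P>(\<omega> in M. maxon X I1 \<omega> \<le> x n) * \<P>(\<omega> in M. maxon X I2 \<omega> \<le> x n)\<bar>)
          ` separated_pairs (q n) n)"

definition AIM_with ::
    "'a measure \<Rightarrow> (nat \<Rightarrow> 'a \<Rightarrow> real) \<Rightarrow> (nat \<Rightarrow> real) \<Rightarrow> (nat \<Rightarrow> nat) \<Rightarrow> bool" where
  "AIM_with M X x q \<longleftrightarrow>
     (\<forall>n\<ge>1. q n \<ge> 1) \<and> (\<lambda>n. real (q n)) \<in> o(\<lambda>n. real n) \<and>
     aim_alpha M X x q \<longlonglongrightarrow> 0"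

text \<open>
  \<open>AIM(x\<^sub>n)\<close> proper. Results that refer to the associated sequences \<open>q\<close> and
  \<open>\<alpha>\<close> use \<^const>\<open>AIM_with\<close>, i.e. they fix a witness \<open>q\<close>.
\<close>

definition AIM :: "'a measure \<Rightarrow> (nat \<Rightarrow> 'a \<Rightarrow> real) \<Rightarrow> (nat \<Rightarrow> real) \<Rightarrow> bool" where
  "AIM M X x \<longleftrightarrow> (\<exists>q. AIM_with M X x q)"

text \<open>
  For \<open>n\<close> with \<open>\<P>(X\<^sub>j > x\<^sub>n) = 0\<close> the conditional probabilities are 0 by
  convention; under \<open>n (1 - F(x\<^sub>n)) \<longlonglongrightarrow> \<tau> > 0\<close> there are only
  finitely many such \<open>n\<close>.
\<close>

definition gamma_seq ::
    "'a measure \<Rightarrow> (nat \<Rightarrow> 'a \<Rightarrow> real) \<Rightarrow> (nat \<Rightarrow> real) \<Rightarrow> (nat \<Rightarrow> nat) \<Rightarrow> nat \<Rightarrow> real" where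
  "gamma_seq M X x p n =
     (1 / real n) *
     (\<Sum>j=1..n. \<P>(\<omega> in M. maxbetween X j (j + p n) \<omega> \<le> x n \<bar> X j \<omega> > x n))"

end

theory Submission
  imports Defs
begin

text \<open>
  The result is a corollary of a finite-\<open>n\<close> estimate: with \<open>f = 1 - F(x\<^sub>n)\<close>, and as soon as
  \<open>1 \<le> q\<close> and \<open>2q \<le> p\<close>, the numbers \<open>P(M\<^sub>n \<le> x\<^sub>n)\<close> and \<open>exp(- n f \<gamma>\<^sub>n)\<close> differ by at most
  \<open>8 n \<alpha> / p + 5 n p f\<^sup>2 + 8 p f\<close> (lemma \<open>maximum_cdf_approx\<close>). Under the hypotheses this bound
  vanishes, since \<open>n p f\<^sup>2 = (n f)\<^sup>2 (p / n)\<close>, and \<open>n f\<close> may be replaced by \<open>\<tau>\<close>. So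
  \<open>P(M\<^sub>n \<le> x\<^sub>n) - exp(- \<tau> \<gamma>\<^sub>n)\<close> tends to 0, and as \<open>g \<mapsto> exp(- \<tau> g)\<close> is a homeomorphism
  of \<open>[0,1]\<close> onto its image, either sequence converges exactly when the other one does.

  For the estimate, let \<open>G(a)\<close> be the probability that no exceedance occurs at a time in \<open>(a, n]\<close>
  and let \<open>D\<^sub>j\<close> be the event that \<open>j\<close> is an exceedance followed by \<open>p\<close> times without one, so that
  the probabilities of \<open>D\<^sub>1, \<dots>, D\<^sub>n\<close> add up to \<open>n f \<gamma>\<^sub>n\<close>. Walk from \<open>0\<close> to \<open>n\<close> in blocks of length
  \<open>h = p - q\<close>. The drop \<open>G(a + h) - G(a)\<close> is the probability that the block \<open>(a, a + h]\<close> is hit and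
  that nothing happens from there to \<open>n\<close>. Up to the event that both this block and a nearby stretch
  behind a gap of length \<open>q\<close> are hit, which mixing bounds by \<open>h p f\<^sup>2 + \<alpha>\<close>, this is the event that some
  \<open>D\<^sub>j\<close> with \<open>j\<close> in the block occurs and the far future is clear. Mixing factorises it, so
  \<open>G(a) \<approx> (1 - \<sigma>) G(a + h)\<close>, where \<open>\<sigma>\<close> is the sum of the \<open>P(D\<^sub>j)\<close> over the block (lemma
  \<open>linear_step\<close>). Moreover \<open>1 - \<sigma> \<approx> exp(- \<sigma>)\<close>, and the exponentials multiply up along the blocks.
  Mixing is thus invoked only a bounded number of times for each of about \<open>n / p\<close> blocks,
  and this is why \<open>n \<alpha>\<^sub>n = o(p\<^sub>n)\<close> suffices.
\<close>

section \<open>Elementary bounds for the exponential\<close>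

lemma exp_minus_second_order:
  fixes t :: real
  assumes "0 \<le> t"
  shows "\<bar>exp (- t) - (1 - t)\<bar> \<le> t\<^sup>2"
proof -
  have "exp (- t) = 1 / exp t" by (simp add: exp_minus inverse_eq_divide)
  also have "\<dots> \<le> 1 / (1 + t)"
    using assms exp_ge_add_one_self[of t] by (intro divide_left_mono) auto
  also have "\<dots> \<le> 1 - t + t\<^sup>2"
  proof -
    have "(1 - t + t\<^sup>2) * (1 + t) = 1 + t ^ 3"
      by (simp add: algebra_simps power2_eq_square power3_eq_cube)
    then have "1 \<le> (1 - t + t\<^sup>2) * (1 + t)" using assms by simp
    then show ?thesis using assms by (simp add: divide_le_eq)
  qed
  finally show ?thesis using exp_ge_add_one_self[of "- t"] by simp
qed

lemma exp_minus_lipschitz: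
  fixes s t :: real
  assumes "0 \<le> s" "0 \<le> t"
  shows "\<bar>exp (- s) - exp (- t)\<bar> \<le> \<bar>s - t\<bar>"
proof -
  have *: "\<bar>exp (- s) - exp (- t)\<bar> \<le> t - s" if "0 \<le> s" "s \<le> t" for s t :: real
  proof -
    have "exp (- s) - exp (- t) = exp (- s) * (1 - exp (s - t))"
      by (simp add: right_diff_distrib flip: exp_add)
    also have "\<dots> \<le> 1 * (t - s)"
    proof (rule mult_mono)
      show "1 - exp (s - t) \<le> t - s" using exp_ge_add_one_self[of "s - t"] by linarith
    qed (use that in auto)
    finally show ?thesis using that by simp
  qed
  show ?thesis
    using *[of s t] *[of t s] assms by (cases "s \<le> t") (auto simp: abs_minus_commute)
qed

section \<open>Rare events that are nearly independent across gaps\<close>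

text \<open>
  For fixed \<open>n\<close> only the events \<open>A i\<close> that the \<open>i\<close>-th variable exceeds the level \<open>x\<^sub>n\<close> matter, and
  the estimate holds for any rare events that mix in this way.
\<close>

locale nearly_independent_gaps = prob_space M for M :: "'a measure" +
  fixes A :: "nat \<Rightarrow> 'a set" and n p q :: nat and \<alpha> f :: real
  assumes events_A: "i \<ge> 1 \<Longrightarrow> A i \<in> events"
    and prob_A_le: "i \<ge> 1 \<Longrightarrow> prob (A i) \<le> f"
    and q_pos: "q \<ge> 1"
    and q_le: "2 * q \<le> p"
    and alpha_nonneg: "0 \<le> \<alpha>"
    and mixing: "(I, J) \<in> separated_pairs q n \<Longrightarrow>
      \<bar>prob {\<omega> \<in> space M. \<forall>i\<in>I \<union> J. \<omega> \<notin> A i}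
       - prob {\<omega> \<in> space M. \<forall>i\<in>I. \<omega> \<notin> A i} * prob {\<omega> \<in> space M. \<forall>i\<in>J. \<omega> \<notin> A i}\<bar> \<le> \<alpha>"
begin

definition clear :: "nat set \<Rightarrow> 'a set" where
  "clear S = {\<omega> \<in> space M. \<forall>i\<in>S. \<omega> \<notin> A i}"

definition hit :: "nat set \<Rightarrow> 'a set" where
  "hit S = space M - clear S"

definition run_end :: "nat \<Rightarrow> 'a set" where
  "run_end j = A j \<inter> clear {j<..j + p}"

lemma f_nonneg: "0 \<le> f"
  using prob_A_le[of 1] measure_nonneg[of M "A 1"] by linarith

lemma clear_Un: "clear (S \<union> T) = clear S \<inter> clear T"
  unfolding clear_def by auto

lemma events_clear [measurable]: "0 \<notin> S \<Longrightarrow> clear S \<in> events"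
proof -
  assume "0 \<notin> S"
  then have "A i \<in> events" if "i \<in> S" for i
    using that events_A[of i] by (cases i) auto
  moreover have "clear S = space M - (\<Union>i\<in>S. A i)"
    unfolding clear_def by auto
  ultimately show ?thesis by (auto intro!: sets.Diff sets.countable_UN')
qed

lemma events_hit [measurable]: "0 \<notin> S \<Longrightarrow> hit S \<in> events"
  unfolding hit_def by auto

lemma events_run_end: "j \<ge> 1 \<Longrightarrow> run_end j \<in> events"
  unfolding run_end_def using events_A by auto

lemma hit_eq_UN: "0 \<notin> S \<Longrightarrow> hit S = (\<Union>i\<in>S. A i)"
proof -
  assume S: "0 \<notin> S"
  have "A i \<subseteq> space M" if "i \<in> S" for i
    using that S events_A[of i] sets.sets_into_space by (cases i) auto
  then show ?thesis unfolding hit_def clear_def by auto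
qed

lemma prob_hit: "0 \<notin> S \<Longrightarrow> prob (hit S) = 1 - prob (clear S)"
  unfolding hit_def by (rule prob_compl) simp

lemma prob_hit_le:
  assumes "finite S" "0 \<notin> S"
  shows "prob (hit S) \<le> card S * f"
proof -
  have ge1: "i \<ge> 1" if "i \<in> S" for i
    using that assms(2) by (cases i) auto
  have "prob (hit S) \<le> (\<Sum>i\<in>S. prob (A i))"
    unfolding hit_eq_UN[OF assms(2)] using ge1 events_A assms(1)
    by (intro finite_measure_subadditive_finite) auto
  also have "\<dots> \<le> (\<Sum>i\<in>S. f)"
    using ge1 by (intro sum_mono prob_A_le) auto
  finally show ?thesis by simp
qed

lemma interval_mixing:
  assumes "a < b" "b + q < c" "q \<le> b - a" "q \<le> c - (b + q)" "c \<le> n"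
  shows "\<bar>prob (clear {a<..b} \<inter> clear {b + q<..c}) - prob (clear {a<..b}) * prob (clear {b + q<..c})\<bar> \<le> \<alpha>"
proof -
  have "({a<..b}, {b + q<..c}) \<in> separated_pairs q n"
    unfolding separated_pairs_def mem_Collect_eq prod.case
    using assms
    by (intro exI[of _ "Suc a"] exI[of _ b] exI[of _ "c - (b + q)"])
       (auto simp: atLeastSucAtMost_greaterThanAtMost)
  from mixing[OF this] show ?thesis
    by (simp add: clear_def[symmetric] clear_Un)
qed

text \<open>
  The defect from independence is the same for two events as for their complements. So mixing,
  although formulated for the absence of exceedances, also makes two exceedances
  across a gap unlikely.
\<close>

lemma prob_two_hits_le:
  assumes "a < b" "b + q < c" "q \<le> b - a" "q \<le> c - (b + q)" "c \<le> n"
  shows "prob (hit {a<..b} \<inter> hit {b + q<..c}) \<le> real (b - a) * f * (real (c - (b + q)) * f) + \<alpha>"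
proof -
  let ?I = "{a<..b}" and ?J = "{b + q<..c}"
  have "prob (clear ?I \<union> hit ?I \<inter> hit ?J) = prob (clear ?I) + prob (hit ?I \<inter> hit ?J)"
    by (rule finite_measure_Union) (auto simp: hit_def)
  moreover have "prob (hit ?J \<union> clear ?I \<inter> clear ?J) = prob (hit ?J) + prob (clear ?I \<inter> clear ?J)"
    by (rule finite_measure_Union) (auto simp: hit_def)
  moreover have "clear ?I \<union> hit ?I \<inter> hit ?J = hit ?J \<union> clear ?I \<inter> clear ?J"
    unfolding hit_def clear_def by auto
  ultimately have "prob (hit ?I \<inter> hit ?J) = prob (hit ?J) + prob (clear ?I \<inter> clear ?J) - prob (clear ?I)"
    by simp
  also have "\<dots> = prob (hit ?I) * prob (hit ?J)
      + (prob (clear ?I \<inter> clear ?J) - prob (clear ?I) * prob (clear ?J))"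
    by (simp add: prob_hit algebra_simps)
  finally have "prob (hit ?I \<inter> hit ?J) = prob (hit ?I) * prob (hit ?J)
      + (prob (clear ?I \<inter> clear ?J) - prob (clear ?I) * prob (clear ?J))" .
  moreover have "prob (hit ?I) * prob (hit ?J) \<le> real (b - a) * f * (real (c - (b + q)) * f)"
    using prob_hit_le[of ?I] prob_hit_le[of ?J] f_nonneg by (intro mult_mono) auto
  ultimately show ?thesis
    using interval_mixing[OF assms] by linarith
qed

lemma prob_clear_diff:
  assumes "S \<subseteq> T" "finite T" "0 \<notin> T"
  shows "prob (clear T) \<le> prob (clear S)"
    and "prob (clear S) - prob (clear T) \<le> real (card (T - S)) * f"
proof -
  have S: "0 \<notin> S" using assms by auto
  have "clear T \<subseteq> clear S" using assms(1) unfolding clear_def by auto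
  then show "prob (clear T) \<le> prob (clear S)"
    using S by (intro finite_measure_mono) auto
  have "clear S \<subseteq> clear T \<union> hit (T - S)" unfolding clear_def hit_def by auto
  then have "prob (clear S) \<le> prob (clear T \<union> hit (T - S))"
    using assms by (intro finite_measure_mono) auto
  also have "\<dots> \<le> prob (clear T) + prob (hit (T - S))"
    using assms by (intro measure_Un_le) auto
  also have "prob (hit (T - S)) \<le> real (card (T - S)) * f"
    using assms by (intro prob_hit_le) auto
  finally show "prob (clear S) - prob (clear T) \<le> real (card (T - S)) * f" by simp
qed

lemma prob_sandwich:
  assumes "S \<subseteq> T" "T - S \<subseteq> B" "S \<in> events" "T \<in> events" "B \<in> events"
  shows "\<bar>prob T - prob S\<bar> \<le> prob B"
proof -
  have "prob S \<le> prob T" using assms by (intro finite_measure_mono) auto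
  moreover have "prob T \<le> prob (S \<union> B)" using assms by (intro finite_measure_mono) auto
  moreover have "prob (S \<union> B) \<le> prob S + prob B"
    using assms by (intro measure_Un_le) auto
  ultimately show ?thesis by linarith
qed

lemma last_hit:
  assumes "\<omega> \<in> hit {a<..b}"
  obtains j where "a < j" "j \<le> b" "\<omega> \<in> A j" "\<omega> \<in> clear {j<..b}"
proof -
  let ?K = "{i \<in> {a<..b}. \<omega> \<in> A i}"
  have K: "finite ?K" "?K \<noteq> {}"
    using assms unfolding hit_def clear_def by auto
  obtain m where m: "m \<in> ?K" "\<And>i. i \<in> ?K \<Longrightarrow> i \<le> m"
    using Max_in[OF K] Max_ge[OF K(1)] by metis
  have "\<omega> \<notin> A i" if "m < i" "i \<le> b" for i
    using m(1) m(2)[of i] that by auto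
  with m(1) assms show thesis
    by (intro that[of m]) (auto simp: clear_def hit_def)
qed

text \<open>
  Two times at which a run ends are more than \<open>p\<close> apart, so within a block of length at most \<open>p\<close>
  the events are disjoint.
\<close>

lemma prob_UN_run_end:
  assumes "b \<le> a + p"
  shows "prob (\<Union>j\<in>{a<..b}. run_end j) = (\<Sum>j\<in>{a<..b}. prob (run_end j))"
proof (rule finite_measure_finite_Union)
  show "disjoint_family_on run_end {a<..b}"
  unfolding disjoint_family_on_def
  proof (intro ballI impI)
    have *: "run_end i \<inter> run_end j = {}" if "i \<in> {a<..b}" "j \<in> {a<..b}" "i < j" for i j
      using that assms by (auto simp: run_end_def clear_def)
    show "run_end i \<inter> run_end j = {}" if "i \<in> {a<..b}" "j \<in> {a<..b}" "i \<noteq> j" for i j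
      using that *[of i j] *[of j i] by (cases "i < j") (auto simp: Int_commute)
  qed
qed (auto intro!: events_run_end)

lemma prob_run_end_le: "j \<ge> 1 \<Longrightarrow> prob (run_end j) \<le> f"
proof -
  assume j: "j \<ge> 1"
  then have "prob (run_end j) \<le> prob (A j)"
    using events_A by (intro finite_measure_mono) (auto simp: run_end_def)
  with prob_A_le[OF j] show ?thesis by simp
qed

lemma sum_run_end_le: "(\<Sum>j\<in>{a<..b}. prob (run_end j)) \<le> real (b - a) * f"
proof -
  have "(\<Sum>j\<in>{a<..b}. prob (run_end j)) \<le> (\<Sum>j\<in>{a<..b}. f)"
    by (intro sum_mono prob_run_end_le) auto
  then show ?thesis by simp
qed

text \<open>
  Let \<open>s = (a, a+h]\<close>. Four events are compared in the proof: \<open>U\<close>, a run ends in \<open>s\<close>; \<open>V\<close>, the block \<open>s\<close> is hit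
  and the next \<open>p\<close> times are clear; \<open>V'\<close>, moreover everything after a further gap of length \<open>q\<close> is
  clear; and \<open>W\<close>, the block is hit and everything after it is clear. Then \<open>V \<subseteq> U\<close> and \<open>W \<subseteq> V'\<close>, and both
  differences lie in the event \<open>B\<close> that \<open>s\<close> and \<open>(a+h+q, a+h+p+q]\<close> are both hit. Being hit is not
  covered by mixing, but \<open>V\<close> is a difference of two clear events, to each of
  which mixing applies.
\<close>

lemma linear_step:
  assumes h: "q \<le> h" "h + q \<le> p" and a: "a + h + p + 2 * q \<le> n"
  defines "\<sigma> \<equiv> \<Sum>j\<in>{a<..a + h}. prob (run_end j)"
  shows "\<bar>prob (clear {a + h<..n}) - prob (clear {a<..n}) - \<sigma> * prob (clear {a + h<..n})\<bar>
    \<le> 4 * \<alpha> + 4 * (real h * real p * f\<^sup>2)"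
proof -
  let ?b = "a + h" and ?c = "a + h + p" and ?d = "a + h + p + q"
  define G where "G k = prob (clear {k<..n})" for k
  define B where "B = hit {a<..?b} \<inter> hit {?b + q<..?d}"
  define U where "U = (\<Union>j\<in>{a<..?b}. run_end j)"
  define V where "V = hit {a<..?b} \<inter> clear {?b<..?c}"
  define V' where "V' = V \<inter> clear {?d<..n}"
  define W where "W = hit {a<..?b} \<inter> clear {?b<..n}"
  have ev: "B \<in> events" "U \<in> events" "V \<in> events" "V' \<in> events" "W \<in> events"
    unfolding B_def U_def V'_def V_def W_def by (auto intro!: events_run_end)
  have split: "clear {i<..k} = clear {i<..j} \<inter> clear {j<..k}" if "i \<le> j" "j \<le> k" for i j k
    using that by (simp add: clear_Un[symmetric] ivl_disj_un_two)
  have diff: "prob (hit S \<inter> clear T) = prob (clear T) - prob (clear S \<inter> clear T)"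
    if "0 \<notin> S" "0 \<notin> T" for S T
  proof -
    have "hit S \<inter> clear T = clear T - clear S \<inter> clear T"
      unfolding hit_def clear_def by auto
    then show ?thesis using that by (simp add: finite_measure_Diff)
  qed
  have B: "prob B \<le> real h * real p * f\<^sup>2 + \<alpha>"
    using prob_two_hits_le[of a ?b ?d] h a q_pos
    by (simp add: B_def power2_eq_square mult_ac)
  have sigma: "\<sigma> = prob U"
    unfolding \<sigma>_def U_def using prob_UN_run_end[of ?b a] h by simp
  have sigma_le: "0 \<le> \<sigma>" "\<sigma> \<le> real h * f"
    unfolding \<sigma>_def using sum_run_end_le[of a ?b] by (auto intro: sum_nonneg)
  have G01: "0 \<le> G k" "G k \<le> 1" for k unfolding G_def by auto
  have W: "G ?b - G a = prob W"
    unfolding W_def G_def using split[of a ?b n] a by (subst diff) auto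
  have WV': "\<bar>prob V' - prob W\<bar> \<le> prob B"
  proof (rule prob_sandwich[OF _ _ ev(5,4,1)])
    show "W \<subseteq> V'"
      unfolding W_def V'_def V_def clear_def using a by auto
    show "V' - W \<subseteq> B"
    proof
      fix \<omega> assume "\<omega> \<in> V' - W"
      then have *: "\<omega> \<in> hit {a<..?b}" "\<omega> \<in> clear {?b<..?c}" "\<omega> \<in> clear {?d<..n}"
        "\<omega> \<notin> clear {?b<..n}"
        unfolding V'_def V_def W_def by auto
      then obtain i where i: "?b < i" "i \<le> n" "\<omega> \<in> A i" and sp: "\<omega> \<in> space M"
        unfolding clear_def by auto
      with * have "\<not> i \<le> ?c" "\<not> ?d < i" unfolding clear_def by auto
      \<comment> \<open>The exceedance lies in the gap \<open>(c, d]\<close>, which is behind \<open>b + q\<close> because \<open>q \<le> p\<close>.\<close>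
      then have "i \<in> {?b + q<..?d}" using h by auto
      with i sp * show "\<omega> \<in> B" unfolding B_def hit_def clear_def by auto
    qed
  qed
  have VU: "\<bar>prob U - prob V\<bar> \<le> prob B"
  proof (rule prob_sandwich[OF _ _ ev(3,2,1)])
    show "V \<subseteq> U"
    proof
      fix \<omega> assume "\<omega> \<in> V"
      then have V: "\<omega> \<in> hit {a<..?b}" "\<omega> \<in> clear {?b<..?c}" unfolding V_def by auto
      from last_hit[OF V(1)] obtain j
        where j: "a < j" "j \<le> ?b" "\<omega> \<in> A j" "\<omega> \<in> clear {j<..?b}" .
      have "\<omega> \<in> clear {j<..?c}" using split[of j ?b ?c] j V by auto
      then have "\<omega> \<in> run_end j" using j unfolding run_end_def clear_def by auto
      with j show "\<omega> \<in> U" unfolding U_def by auto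
    qed
    show "U - V \<subseteq> B"
    proof
      fix \<omega> assume \<omega>: "\<omega> \<in> U - V"
      then obtain j where j: "a < j" "j \<le> ?b" "\<omega> \<in> A j" "\<omega> \<in> clear {j<..j + p}"
        unfolding U_def run_end_def by auto
      then have hit: "\<omega> \<in> hit {a<..?b}" unfolding hit_def clear_def by auto
      with \<omega> obtain i where i: "?b < i" "i \<le> ?c" "\<omega> \<in> A i" and sp: "\<omega> \<in> space M"
        unfolding V_def clear_def hit_def by auto
      with j have "\<not> i \<le> j + p" unfolding clear_def by auto
      \<comment> \<open>Since \<open>a < j\<close>, the exceedance comes after \<open>a + p\<close>, hence after \<open>b + q\<close> by \<open>h + q \<le> p\<close>.\<close>
      with j h i have "i \<in> {?b + q<..?d}" by auto
      with i sp hit show "\<omega> \<in> B" unfolding B_def hit_def clear_def by auto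
    qed
  qed
  have V': "\<bar>prob V' - prob V * G ?d\<bar> \<le> 2 * \<alpha>"
  proof -
    let ?J = "clear {?d<..n}"
    define u v where "u = prob (clear {?b<..?c} \<inter> ?J)" and "v = prob (clear {a<..?c} \<inter> ?J)"
    define w z where "w = prob (clear {?b<..?c})" and "z = prob (clear {a<..?c})"
    have "prob V = w - z"
      unfolding V_def w_def z_def using split[of a ?b ?c] by (subst diff) auto
    moreover have "prob V' = u - v"
    proof -
      have "prob V' = prob (hit {a<..?b} \<inter> clear ({?b<..?c} \<union> {?d<..n}))"
        unfolding V'_def V_def clear_Un by (simp add: Int_assoc)
      also have "\<dots> = prob (clear ({?b<..?c} \<union> {?d<..n}))
          - prob (clear {a<..?b} \<inter> clear ({?b<..?c} \<union> {?d<..n}))"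
        by (rule diff) auto
      finally show ?thesis
        using split[of a ?b ?c] by (simp add: clear_Un Int_assoc u_def v_def)
    qed
    moreover have "\<bar>u - w * G ?d\<bar> \<le> \<alpha>"
      unfolding G_def u_def w_def using interval_mixing[of ?b ?c n] h a q_pos by simp
    moreover have "\<bar>v - z * G ?d\<bar> \<le> \<alpha>"
      unfolding G_def v_def z_def using interval_mixing[of a ?c n] h a q_pos by simp
    ultimately show ?thesis by (simp add: left_diff_distrib)
  qed
  have VG: "\<bar>prob V * G ?d - \<sigma> * G ?d\<bar> \<le> prob B"
  proof -
    have "\<bar>prob V * G ?d - \<sigma> * G ?d\<bar> = \<bar>prob U - prob V\<bar> * G ?d"
      using G01[of ?d] sigma by (simp add: left_diff_distrib[symmetric] abs_mult abs_minus_commute)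
    also have "\<dots> \<le> prob B * 1"
      using VU G01[of ?d] by (intro mult_mono) auto
    finally show ?thesis by simp
  qed
  have "\<bar>\<sigma> * G ?d - \<sigma> * G ?b\<bar> \<le> 2 * (real h * real p * f\<^sup>2)"
  proof -
    have "{?b<..n} - {?d<..n} = {?b<..?d}" using a by auto
    then have "card ({?b<..n} - {?d<..n}) = p + q" by simp
    moreover have "{?d<..n} \<subseteq> {?b<..n}" by auto
    note prob_clear_diff[OF this]
    ultimately have "\<bar>G ?d - G ?b\<bar> \<le> real (p + q) * f" unfolding G_def by simp
    also have "\<dots> \<le> 2 * real p * f"
      using q_le f_nonneg by (intro mult_right_mono) auto
    finally have "\<sigma> * \<bar>G ?d - G ?b\<bar> \<le> (real h * f) * (2 * real p * f)"
      using sigma_le f_nonneg by (intro mult_mono) auto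
    moreover have "\<bar>\<sigma> * G ?d - \<sigma> * G ?b\<bar> = \<sigma> * \<bar>G ?d - G ?b\<bar>"
      unfolding right_diff_distrib[symmetric] abs_mult using sigma_le by simp
    moreover have "(real h * f) * (2 * real p * f) = 2 * (real h * real p * f\<^sup>2)"
      by (simp add: power2_eq_square)
    ultimately show ?thesis by simp
  qed
  then have "\<bar>(prob W - prob V') + (prob V' - prob V * G ?d) + (prob V * G ?d - \<sigma> * G ?d)
      + (\<sigma> * G ?d - \<sigma> * G ?b)\<bar> \<le> prob B + 2 * \<alpha> + prob B + 2 * (real h * real p * f\<^sup>2)"
    using WV' V' VG by (intro order.trans[OF abs_triangle_ineq] add_mono) (simp_all only: abs_minus_commute)
  then have "\<bar>G ?b - G a - \<sigma> * G ?b\<bar> \<le> 4 * \<alpha> + 4 * (real h * real p * f\<^sup>2)"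
    using B W by simp
  then show ?thesis unfolding G_def .
qed

text \<open>
  In this form the errors of successive steps merely add up, because the factors
  \<open>exp(- \<sigma>)\<close> are at most 1.
\<close>

lemma exponential_step:
  assumes h: "q \<le> h" "h + q \<le> p" and a: "a + h + p + 2 * q \<le> n"
  shows "\<bar>prob (clear {a<..n})
      - prob (clear {a + h<..n}) * exp (- (\<Sum>j\<in>{a<..a + h}. prob (run_end j)))\<bar>
    \<le> 4 * \<alpha> + 5 * (real h * real p * f\<^sup>2)"
proof -
  define \<sigma> where "\<sigma> = (\<Sum>j\<in>{a<..a + h}. prob (run_end j))"
  let ?G = "prob (clear {a + h<..n})"
  have \<sigma>: "0 \<le> \<sigma>" "\<sigma> \<le> real h * f"
    unfolding \<sigma>_def using sum_run_end_le[of a "a + h"] by (auto intro: sum_nonneg)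
  have "?G * \<bar>exp (- \<sigma>) - (1 - \<sigma>)\<bar> \<le> 1 * \<sigma>\<^sup>2"
    using exp_minus_second_order[OF \<sigma>(1)] by (intro mult_mono) auto
  moreover have "?G * exp (- \<sigma>) - (?G - \<sigma> * ?G) = ?G * (exp (- \<sigma>) - (1 - \<sigma>))"
    by (simp add: algebra_simps)
  ultimately have "\<bar>?G * exp (- \<sigma>) - (?G - \<sigma> * ?G)\<bar> \<le> \<sigma>\<^sup>2"
    by (simp add: abs_mult)
  moreover have "\<sigma>\<^sup>2 \<le> real h * real p * f\<^sup>2"
  proof -
    have "\<sigma>\<^sup>2 \<le> (real h * f)\<^sup>2" using \<sigma> by (intro power_mono) auto
    also have "\<dots> = real h * real h * f\<^sup>2" by (simp add: power2_eq_square)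
    also have "\<dots> \<le> real h * real p * f\<^sup>2"
      using h by (intro mult_right_mono mult_left_mono) auto
    finally show ?thesis .
  qed
  ultimately show ?thesis
    using linear_step[OF assms] unfolding \<sigma>_def by linarith
qed

lemma iterated_steps:
  assumes h: "q \<le> h" "h + q \<le> p"
  shows "k = 0 \<or> k * h + p + 2 * q \<le> n \<Longrightarrow>
    \<bar>prob (clear {0<..n}) - prob (clear {k * h<..n}) * exp (- (\<Sum>j\<in>{0<..k * h}. prob (run_end j)))\<bar>
    \<le> real k * (4 * \<alpha> + 5 * (real h * real p * f\<^sup>2))"
proof (induction k)
  case (Suc k)
  let ?E = "4 * \<alpha> + 5 * (real h * real p * f\<^sup>2)"
  let ?G = "\<lambda>a. prob (clear {a<..n})" and ?S = "\<lambda>a b. \<Sum>j\<in>{a<..b}. prob (run_end j)"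
  let ?a = "k * h"
  have n: "?a + h + p + 2 * q \<le> n" using Suc.prems by simp
  have "?S 0 (?a + h) = ?S 0 ?a + ?S ?a (?a + h)"
    using sum.union_disjoint[of "{0<..?a}" "{?a<..?a + h}" "\<lambda>j. prob (run_end j)"]
    by (simp add: ivl_disj_un_two ivl_disj_int_two)
  then have "exp (- ?S 0 (?a + h)) = exp (- ?S 0 ?a) * exp (- ?S ?a (?a + h))"
    by (simp only: minus_add_distrib exp_add)
  then have "?G ?a * exp (- ?S 0 ?a) - ?G (?a + h) * exp (- ?S 0 (?a + h))
      = exp (- ?S 0 ?a) * (?G ?a - ?G (?a + h) * exp (- ?S ?a (?a + h)))"
    by (simp only: right_diff_distrib mult_ac)
  then have "\<bar>?G ?a * exp (- ?S 0 ?a) - ?G (?a + h) * exp (- ?S 0 (?a + h))\<bar>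
      = exp (- ?S 0 ?a) * \<bar>?G ?a - ?G (?a + h) * exp (- ?S ?a (?a + h))\<bar>"
    by (simp add: abs_mult)
  also have "\<dots> \<le> 1 * ?E"
    using exponential_step[OF h n] by (intro mult_mono) (auto intro!: sum_nonneg)
  finally have "\<bar>?G ?a * exp (- ?S 0 ?a) - ?G (?a + h) * exp (- ?S 0 (?a + h))\<bar> \<le> ?E"
    by simp
  moreover have "\<bar>?G 0 - ?G ?a * exp (- ?S 0 ?a)\<bar> \<le> real k * ?E"
    using n by (intro Suc.IH) auto
  moreover have "real (Suc k) * ?E = real k * ?E + ?E" by (simp add: algebra_simps)
  ultimately have "\<bar>?G 0 - ?G (?a + h) * exp (- ?S 0 (?a + h))\<bar> \<le> real (Suc k) * ?E"
    by linarith
  then show ?case by (simp only: mult_Suc add.commute[of h])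
qed simp

text \<open>
  The blocks have length \<open>h = p - q \<ge> p / 2\<close>, the largest that \<open>linear_step\<close> admits. As each step needs
  room for \<open>p + 2q\<close> further times, the walk stops at most \<open>4p\<close> before \<open>n\<close>. The remainder costs
  \<open>4 p f\<close> in the probability and another \<open>4 p f\<close> in the exponent.
\<close>

lemma prob_clear_approx:
  "\<bar>prob (clear {0<..n}) - exp (- (\<Sum>j\<in>{0<..n}. prob (run_end j)))\<bar>
    \<le> 8 * (real n * \<alpha> / real p) + 5 * (real n * real p * f\<^sup>2) + 8 * (real p * f)"
proof -
  define h where "h = p - q"
  have h: "q \<le> h" "h + q \<le> p" "p \<le> 2 * h" "h \<ge> 1"
    using q_le q_pos unfolding h_def by auto
  define k where "k = (n - (p + 2 * q)) div h"
  let ?G = "\<lambda>a. prob (clear {a<..n})" and ?S = "\<lambda>b. \<Sum>j\<in>{0<..b}. prob (run_end j)"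
  let ?a = "k * h"
  have ka: "?a \<le> n - (p + 2 * q)" unfolding k_def by simp
  have tail: "n - ?a \<le> 4 * p"
  proof -
    have "n - (p + 2 * q) = ?a + (n - (p + 2 * q)) mod h" unfolding k_def by simp
    moreover have "(n - (p + 2 * q)) mod h < h" using h by simp
    ultimately show ?thesis using h q_le by linarith
  qed
  have "k = 0 \<or> ?a + p + 2 * q \<le> n"
  proof (cases "n \<le> p + 2 * q")
    case True
    then show ?thesis unfolding k_def by simp
  next
    case False
    then show ?thesis using ka by linarith
  qed
  from iterated_steps[OF h(1,2) this]
  have "\<bar>?G 0 - ?G ?a * exp (- ?S ?a)\<bar> \<le> real k * (4 * \<alpha> + 5 * (real h * real p * f\<^sup>2))" .
  also have "\<dots> \<le> 8 * (real n * \<alpha> / real p) + 5 * (real n * real p * f\<^sup>2)"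
  proof -
    have kh: "real k * real h \<le> real n" using ka by (simp flip: of_nat_mult)
    have "real k * real p \<le> real k * (2 * real h)" using h by (intro mult_left_mono) auto
    then have "real k * real p \<le> 2 * real n" using kh by simp
    then have "real k * real p * \<alpha> \<le> 2 * real n * \<alpha>" using alpha_nonneg by (intro mult_right_mono)
    then have "real k * \<alpha> \<le> 2 * (real n * \<alpha> / real p)"
      using h q_pos by (simp add: field_simps)
    moreover have "real k * real h * (real p * f\<^sup>2) \<le> real n * (real p * f\<^sup>2)"
      using kh by (intro mult_right_mono) auto
    moreover have "real k * (4 * \<alpha> + 5 * (real h * real p * f\<^sup>2))
        = 4 * (real k * \<alpha>) + 5 * (real k * real h * (real p * f\<^sup>2))"
      by (simp add: distrib_left)
    ultimately show ?thesis by (simp add: mult.assoc)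
  qed
  finally have main: "\<bar>?G 0 - ?G ?a * exp (- ?S ?a)\<bar>
    \<le> 8 * (real n * \<alpha> / real p) + 5 * (real n * real p * f\<^sup>2)" .
  have tailf: "real (n - ?a) * f \<le> 4 * (real p * f)"
  proof -
    have "real (n - ?a) * f \<le> real (4 * p) * f"
      using tail f_nonneg by (intro mult_right_mono) (auto simp del: of_nat_mult)
    then show ?thesis by simp
  qed
  have "prob (clear {}) = 1" unfolding clear_def by (simp add: prob_space)
  then have "\<bar>?G ?a - 1\<bar> \<le> 4 * (real p * f)"
    using prob_clear_diff[of "{}" "{?a<..n}"] tailf by auto
  then have "\<bar>?G ?a - 1\<bar> * exp (- ?S ?a) \<le> 4 * (real p * f) * 1"
    using f_nonneg by (intro mult_mono) (auto intro!: sum_nonneg)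
  then have "\<bar>?G ?a * exp (- ?S ?a) - exp (- ?S ?a)\<bar> \<le> 4 * (real p * f)"
    using abs_mult[of "?G ?a - 1" "exp (- ?S ?a)"]
    by (simp only: left_diff_distrib mult_1_left mult_1_right abs_exp_cancel)
  moreover have "\<bar>exp (- ?S ?a) - exp (- ?S n)\<bar> \<le> 4 * (real p * f)"
  proof -
    have "?S n = ?S ?a + (\<Sum>j\<in>{?a<..n}. prob (run_end j))"
      using sum.union_disjoint[of "{0<..?a}" "{?a<..n}" "\<lambda>j. prob (run_end j)"] ka
      by (simp add: ivl_disj_un_two ivl_disj_int_two)
    then have "\<bar>?S ?a - ?S n\<bar> \<le> real (n - ?a) * f"
      using sum_run_end_le[of ?a n] by (simp add: sum_nonneg)
    moreover have "\<bar>exp (- ?S ?a) - exp (- ?S n)\<bar> \<le> \<bar>?S ?a - ?S n\<bar>"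
      by (intro exp_minus_lipschitz sum_nonneg) auto
    ultimately show ?thesis using tailf by linarith
  qed
  ultimately show ?thesis using main by linarith
qed

end

section \<open>Maxima of random variables\<close>

lemma maxon_le_iff:
  assumes "finite S" "S \<noteq> {}"
  shows "maxon X S \<omega> \<le> t \<longleftrightarrow> (\<forall>i\<in>S. X i \<omega> \<le> t)"
  unfolding maxon_def using assms by (subst Max_le_iff) auto

lemma aim_alpha_ge:
  assumes "(I, J) \<in> separated_pairs (q n) n"
  shows "\<bar>\<P>(\<omega> in M. maxon X (I \<union> J) \<omega> \<le> x n)
      - \<P>(\<omega> in M. maxon X I \<omega> \<le> x n) * \<P>(\<omega> in M. maxon X J \<omega> \<le> x n)\<bar>
    \<le> aim_alpha M X x q n"
proof -
  have "separated_pairs (q n) n \<subseteq> Pow {..n} \<times> Pow {..n}"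
    unfolding separated_pairs_def by fastforce
  then have "finite (separated_pairs (q n) n)"
    by (rule finite_subset) simp
  then show ?thesis
    unfolding aim_alpha_def using assms
    by (intro Max_ge finite_imageI) (force intro: image_eqI[where x = "(I, J)"])+
qed

lemma prob_exceeds:
  assumes "prob_space M" "Y \<in> borel_measurable M"
  shows "\<P>(\<omega> in M. Y \<omega> > t) = 1 - cdf (distr M borel Y) t"
proof -
  interpret prob_space M by fact
  have "Y -` {..t} \<inter> space M = {\<omega> \<in> space M. \<not> Y \<omega> > t}" by auto
  moreover have "{\<omega> \<in> space M. Y \<omega> > t} \<in> events" using assms(2) by measurable
  ultimately show ?thesis
    using assms(2) by (simp add: cdf_def measure_distr prob_neg)
qed

text \<open>
  The exceedances of the level are the rare events, and \<open>n f \<gamma>\<^sub>n\<close> is the sum of the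
  probabilities that runs end at \<open>1, \<dots>, n\<close>. The absolute value around \<open>\<alpha>\<^sub>n\<close> is there because
  the maximum defining it is unspecified, and possibly negative, when no separated pair exists.
\<close>

lemma maximum_cdf_approx:
  fixes X :: "nat \<Rightarrow> 'a \<Rightarrow> real"
  assumes "prob_space M"
    and meas: "\<And>i. i \<ge> 1 \<Longrightarrow> X i \<in> borel_measurable M"
    and cdf: "\<And>i. i \<ge> 1 \<Longrightarrow> cdf (distr M borel (X i)) = F"
    and n: "n \<ge> 1" and q: "q n \<ge> 1" "2 * q n \<le> p n"
  shows "\<bar>\<P>(\<omega> in M. maxupto X n \<omega> \<le> x n)
      - exp (- (real n * (1 - F (x n)) * gamma_seq M X x p n))\<bar>
    \<le> 8 * (real n * \<bar>aim_alpha M X x q n\<bar> / real (p n))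
      + 5 * (real n * real (p n) * (1 - F (x n))\<^sup>2) + 8 * (real (p n) * (1 - F (x n)))"
proof -
  interpret prob_space M by fact
  define A where "A i = {\<omega> \<in> space M. X i \<omega> > x n}" for i
  define f where "f = 1 - F (x n)"
  have A: "prob (A i) = f" if "i \<ge> 1" for i
    unfolding A_def f_def using prob_exceeds[OF assms(1) meas[OF that]] cdf[OF that] by simp
  have avoid: "{\<omega> \<in> space M. \<forall>i\<in>S. \<omega> \<notin> A i} = {\<omega> \<in> space M. maxon X S \<omega> \<le> x n}"
    if "finite S" "S \<noteq> {}" for S
    using that by (auto simp: A_def maxon_le_iff not_less)
  interpret nearly_independent_gaps M A n "p n" "q n" "\<bar>aim_alpha M X x q n\<bar>" f
  proof
    show "A i \<in> events" if "i \<ge> 1" for i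
      unfolding A_def using meas[OF that] by measurable
    fix I J assume IJ: "(I, J) \<in> separated_pairs (q n) n"
    then have "finite I" "finite J" "I \<noteq> {}" "J \<noteq> {}"
      unfolding separated_pairs_def by auto
    then show "\<bar>prob {\<omega> \<in> space M. \<forall>i\<in>I \<union> J. \<omega> \<notin> A i}
       - prob {\<omega> \<in> space M. \<forall>i\<in>I. \<omega> \<notin> A i} * prob {\<omega> \<in> space M. \<forall>i\<in>J. \<omega> \<notin> A i}\<bar>
       \<le> \<bar>aim_alpha M X x q n\<bar>"
      using aim_alpha_ge[where q = q and n = n and x = x, OF IJ, of M X] by (simp add: avoid)
  qed (use A q in auto)
  have "real n * f * gamma_seq M X x p n
      = (\<Sum>j = 1..n. f * \<P>(\<omega> in M. maxbetween X j (j + p n) \<omega> \<le> x n \<bar> X j \<omega> > x n))"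
    unfolding gamma_seq_def using n by (simp add: sum_distrib_left)
  also have "\<dots> = (\<Sum>j\<in>{0<..n}. prob (run_end j))"
  proof (rule sum.cong)
    fix j assume "j \<in> {0<..n}"
    then have j: "j \<ge> 1" by simp
    have "run_end j = {\<omega> \<in> space M. maxbetween X j (j + p n) \<omega> \<le> x n \<and> X j \<omega> > x n}"
      unfolding run_end_def clear_def using q
      by (auto simp: A_def maxon_le_iff not_less)
    moreover have "f = 0 \<Longrightarrow> prob (run_end j) = 0"
      using prob_run_end_le[OF j] measure_nonneg[of M "run_end j"] by linarith
    \<comment> \<open>If \<open>f = 0\<close> the conditional probability is the quotient \<open>0 / 0 = 0\<close>, and both sides vanish.\<close>
    ultimately show "f * \<P>(\<omega> in M. maxbetween X j (j + p n) \<omega> \<le> x n \<bar> X j \<omega> > x n) = prob (run_end j)"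
      using A[OF j] by (auto simp: cond_prob_def A_def)
  qed (auto simp: atLeastSucAtMost_greaterThanAtMost)
  finally have "(\<Sum>j\<in>{0<..n}. prob (run_end j)) = real n * f * gamma_seq M X x p n" ..
  moreover have "clear {0<..n} = {\<omega> \<in> space M. maxupto X n \<omega> \<le> x n}"
    unfolding clear_def using n by (subst avoid) (auto simp: atLeastSucAtMost_greaterThanAtMost)
  ultimately show ?thesis
    using prob_clear_approx unfolding f_def by simp
qed

lemma gamma_seq_bounds:
  assumes "prob_space M" "\<And>i. i \<ge> 1 \<Longrightarrow> X i \<in> borel_measurable M"
  shows "0 \<le> gamma_seq M X x p n" "gamma_seq M X x p n \<le> 1"
proof -
  interpret prob_space M by fact
  let ?c = "\<lambda>j. \<P>(\<omega> in M. maxbetween X j (j + p n) \<omega> \<le> x n \<bar> X j \<omega> > x n)"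
  have c0: "0 \<le> ?c j" for j by (simp add: cond_prob_def)
  have c1: "?c j \<le> 1" if "j \<in> {1..n}" for j
  proof -
    have "{\<omega> \<in> space M. X j \<omega> > x n} \<in> events"
    proof -
      have "X j \<in> borel_measurable M" using assms(2) that by simp
      then show ?thesis by measurable
    qed
    then show ?thesis
      unfolding cond_prob_def by (intro divide_le_eq_1[THEN iffD2]) (auto simp: zero_less_measure_iff intro!: finite_measure_mono)
  qed
  show "0 \<le> gamma_seq M X x p n"
    unfolding gamma_seq_def using c0 by (simp add: sum_nonneg)
  have "sum ?c {1..n} \<le> (\<Sum>j = 1..n. 1)" by (rule sum_mono) (rule c1)
  then show "gamma_seq M X x p n \<le> 1"
    unfolding gamma_seq_def by (cases "n = 0") (auto simp: divide_le_eq)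
qed

section \<open>Passage to the limit\<close>

text \<open>
  Recovering the limit of \<open>g\<close> from that of \<open>P\<close> takes a logarithm; the bound \<open>g \<le> 1\<close> keeps the limit of
  \<open>P\<close> above \<open>exp(- \<tau>)\<close>, hence away from 0.
\<close>

lemma limits_from_exp_approx:
  fixes P g :: "nat \<Rightarrow> real"
  assumes "\<tau> > 0" and approx: "(\<lambda>n. P n - exp (- \<tau> * g n)) \<longlonglongrightarrow> 0"
    and g: "\<And>n. 0 \<le> g n" "\<And>n. g n \<le> 1"
  shows "(convergent P \<longleftrightarrow> convergent g) \<and>
    (\<forall>l. g \<longlonglongrightarrow> l \<longrightarrow> l \<in> {0..1} \<and> P \<longlonglongrightarrow> exp (- \<tau> * l))"
proof -
  have lim: "l \<in> {0..1} \<and> P \<longlonglongrightarrow> exp (- \<tau> * l)" if "g \<longlonglongrightarrow> l" for l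
  proof
    show "l \<in> {0..1}"
      using LIMSEQ_le_const[OF that, of 0] LIMSEQ_le_const2[OF that, of 1] g by auto
    have "(\<lambda>n. exp (- \<tau> * g n)) \<longlonglongrightarrow> exp (- \<tau> * l)"
      using that by (intro tendsto_intros)
    from tendsto_add[OF approx this] show "P \<longlonglongrightarrow> exp (- \<tau> * l)" by simp
  qed
  moreover have "convergent g" if "convergent P"
  proof -
    from that obtain L where "P \<longlonglongrightarrow> L" unfolding convergent_def by auto
    from tendsto_diff[OF this approx] have L: "(\<lambda>n. exp (- \<tau> * g n)) \<longlonglongrightarrow> L" by simp
    have "exp (- \<tau>) \<le> exp (- \<tau> * g n)" for n
      using assms(1) g[of n] by simp
    with L have "exp (- \<tau>) \<le> L" by (intro LIMSEQ_le_const[OF L]) auto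
    then have "L > 0" using exp_gt_zero[of "- \<tau>"] by linarith
    then have "(\<lambda>n. ln (exp (- \<tau> * g n))) \<longlonglongrightarrow> ln L" by (intro tendsto_ln L) simp
    then have "(\<lambda>n. - \<tau> * g n) \<longlonglongrightarrow> ln L" by simp
    from tendsto_mult_left[OF this, of "- 1 / \<tau>"]
    have "g \<longlonglongrightarrow> - 1 / \<tau> * ln L" using assms(1) by simp
    then show ?thesis unfolding convergent_def by auto
  qed
  ultimately show ?thesis unfolding convergent_def by blast
qed

theorem corollary2p2:
  fixes M :: "'a measure"
    and X :: "nat \<Rightarrow> 'a \<Rightarrow> real"
    and F :: "real \<Rightarrow> real"
    and x :: "nat \<Rightarrow> real"
    and \<tau> :: real
    and p q :: "nat \<Rightarrow> nat"
  assumes "prob_space M"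
    and "\<And>n. n \<ge> 1 \<Longrightarrow> X n \<in> borel_measurable M"
    and "\<And>n. n \<ge> 1 \<Longrightarrow> cdf (distr M borel (X n)) = F"
    and "\<tau> > 0"
    and "(\<lambda>n. real n * (1 - F (x n))) \<longlonglongrightarrow> \<tau>"
    and "AIM_with M X x q"
    and "\<And>n. n \<ge> 1 \<Longrightarrow> p n \<ge> 1"
    and "(\<lambda>n. real (p n)) \<in> o(\<lambda>n. real n)"
    and "(\<lambda>n. real n * aim_alpha M X x q n) \<in> o(\<lambda>n. real (p n))"
    and "(\<lambda>n. real (q n)) \<in> o(\<lambda>n. real (p n))"
  shows "(convergent (\<lambda>n. \<P>(\<omega> in M. maxupto X n \<omega> \<le> x n)) \<longleftrightarrow>
            convergent (gamma_seq M X x p)) \<and>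
         (\<forall>\<gamma>. gamma_seq M X x p \<longlonglongrightarrow> \<gamma> \<longrightarrow>
            \<gamma> \<in> {0..1} \<and>
            (\<lambda>n. \<P>(\<omega> in M. maxupto X n \<omega> \<le> x n)) \<longlonglongrightarrow> exp (- \<tau> * \<gamma>))"
proof (rule limits_from_exp_approx[OF assms(4)])
  let ?P = "\<lambda>n. \<P>(\<omega> in M. maxupto X n \<omega> \<le> x n)" and ?g = "gamma_seq M X x p"
  define f where "f n = 1 - F (x n)" for n
  note g = gamma_seq_bounds[OF assms(1,2)]
  show "0 \<le> ?g n" "?g n \<le> 1" for n using g by auto
  have nf: "(\<lambda>n. real n * f n) \<longlonglongrightarrow> \<tau>" using assms(5) by (simp add: f_def)
  have pn: "(\<lambda>n. real (p n) / real n) \<longlonglongrightarrow> 0" by (rule smalloD_tendsto) fact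
  have alpha: "(\<lambda>n. real n * \<bar>aim_alpha M X x q n\<bar> / real (p n)) \<longlonglongrightarrow> 0"
    using tendsto_rabs[OF smalloD_tendsto[OF assms(9)]] by (simp add: abs_mult)
  let ?E = "\<lambda>n. 8 * (real n * \<bar>aim_alpha M X x q n\<bar> / real (p n))
      + 5 * (real n * real (p n) * (f n)\<^sup>2) + 8 * (real (p n) * f n)"
  have "(\<lambda>n. 8 * (real n * \<bar>aim_alpha M X x q n\<bar> / real (p n))
      + 5 * ((real n * f n)\<^sup>2 * (real (p n) / real n)) + 8 * ((real n * f n) * (real (p n) / real n)))
    \<longlonglongrightarrow> 8 * 0 + 5 * (\<tau>\<^sup>2 * 0) + 8 * (\<tau> * 0)"
    by (intro tendsto_intros nf pn alpha)
  moreover have "\<forall>\<^sub>F n in sequentially. 8 * (real n * \<bar>aim_alpha M X x q n\<bar> / real (p n))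
      + 5 * ((real n * f n)\<^sup>2 * (real (p n) / real n)) + 8 * ((real n * f n) * (real (p n) / real n))
    = ?E n"
    using eventually_gt_at_top[of 0]
    by eventually_elim (simp add: power2_eq_square)
  ultimately have E: "?E \<longlonglongrightarrow> 0" using Lim_transform_eventually by fastforce
  have "\<forall>\<^sub>F n in sequentially. norm (real (q n)) \<le> 1 / 2 * norm (real (p n))"
    using assms(10) by (rule landau_o.smallD) simp
  then have "\<forall>\<^sub>F n in sequentially. norm (?P n - exp (- (real n * f n * ?g n))) \<le> ?E n"
    using eventually_ge_at_top[of 1]
  proof eventually_elim
    case (elim n)
    then have "q n \<ge> 1" "2 * q n \<le> p n" using assms(6) unfolding AIM_with_def by auto
    from maximum_cdf_approx[where q = q and p = p and n = n and x = x, OF assms(1-3) elim(2) this] show ?case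
      by (simp add: f_def)
  qed
  from Lim_null_comparison[OF this E]
  have "(\<lambda>n. ?P n - exp (- (real n * f n * ?g n))) \<longlonglongrightarrow> 0" .
  moreover have "(\<lambda>n. exp (- (real n * f n * ?g n)) - exp (- \<tau> * ?g n)) \<longlonglongrightarrow> 0"
  proof (rule Lim_null_comparison)
    show "(\<lambda>n. \<bar>real n * f n - \<tau>\<bar>) \<longlonglongrightarrow> 0"
      using tendsto_rabs[OF LIM_zero[OF nf]] by simp
    have "\<forall>\<^sub>F n in sequentially. real n * f n > 0"
      using order_tendstoD(1)[OF nf assms(4)] .
    then show "\<forall>\<^sub>F n in sequentially.
        norm (exp (- (real n * f n * ?g n)) - exp (- \<tau> * ?g n)) \<le> \<bar>real n * f n - \<tau>\<bar>"
    proof eventually_elim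
      case (elim n)
      have "norm (exp (- (real n * f n * ?g n)) - exp (- \<tau> * ?g n))
          \<le> \<bar>real n * f n * ?g n - \<tau> * ?g n\<bar>"
        using exp_minus_lipschitz[of "real n * f n * ?g n" "\<tau> * ?g n"] elim assms(4) g[where x = x and p = p and n = n] by simp
      also have "\<dots> = \<bar>real n * f n - \<tau>\<bar> * ?g n"
        using g[where x = x and p = p and n = n] by (simp add: abs_mult flip: left_diff_distrib)
      also have "\<dots> \<le> \<bar>real n * f n - \<tau>\<bar> * 1"
        using g[where x = x and p = p and n = n] by (intro mult_left_mono) auto
      finally show ?case by simp
    qed
  qed
  ultimately show "(\<lambda>n. ?P n - exp (- \<tau> * ?g n)) \<longlonglongrightarrow> 0"
    using tendsto_add by fastforce
qed

end
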